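(* Let $\boldsymbol p=(p,0)$ or $\boldsymbol p=(0,p)$ with $p\in\mathbb N=\{1,2,\dots\}$, and let $\check{\boldsymbol p}$ be its dual. The symmetric Berezin correspondence for $\boldsymbol p$ is antipodal to the symmetric Berezin correspondence for $\check{\boldsymbol p}$, and the symmetric Stratonovich-Weyl correspondence for $\boldsymbol p$ is antipodal to the symmetric Stratonovich-Weyl correspondence for $\check{\boldsymbol p}$.
   Context: For $\boldsymbol p=(p,q)\in\mathbb N_0^2$, $\mathcal H_{\boldsymbol p}$ carries the unitary irrep $\rho$ of $SU(3)$ with highest weight $p\varpi_1+q\varpi_2$ ($\varpi_i$ the fundamental weights; $(1,0)$ is the defining representation; highest/lowest weights are with respect to the upper triangular raising operators); $\check{\boldsymbol p}=(q,p)$ and $\mathcal H_{\check{\boldsymbol p}}=\mathcal H_{\boldsymbol p}^*$ with the dual representation. $\mathcal B(\mathcal H_{\boldsymbol p})$ carries the action $A^g=\rho(g)A\rho(g)^{-1}$ and the inner product $\langle A_1|A_2\rangle_{\boldsymbol p}=\frac1{\dim(\boldsymbol p)}\operatorname{tr}(A_1^\dagger A_2)$, $\dim(\boldsymbol p)=\dim\mathcal H_{\boldsymbol p}$. For $A\in\mathcal B(\mathcal H_{\boldsymbol p})$, $A^*\in\mathcal B(\mathcal H_{\boldsymbol p}^* )$ is the adjoint (transpose) $A^*\varphi=\varphi\circ A$. $\mathbb CP^2\simeq SU(3)/H$, $H=\{\mathrm{diag}(\det(U)^{-1},U):U\in U(2)\}$ the isotropy group of $\mathrm x_0=[1:0:0]$,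 with the invariant integral of total mass $1$ and $\langle f_1|f_2\rangle=\int\overline{f_1}f_2\,d\mathrm x$. A symbol correspondence $W:\mathcal B(\mathcal H_{\boldsymbol p})\to C^\infty_{\mathbb C}(\mathbb CP^2)$ is an injective linear map with: (1) $W_{A^g}=(W_A)^g$, where $f^g(\mathrm x)=f(g^{-1}\mathrm x)$; (2) $W_{A^\dagger}=\overline{W_A}$; (3) $\int W_A\,d\mathrm x=\operatorname{tr}(A)/\dim(\boldsymbol p)$. Each has a unique operator kernel $K\in\mathcal B(\mathcal H_{\boldsymbol p})$, fixed by $H$, with $W_A(g\mathrm x_0)=\operatorname{tr}(AK^g)$. The moduli space $\mathcal M_{\boldsymbol p}(\mathbb CP^2)\subset\mathcal B(\mathcal H_{\boldsymbol p})$ is the set of all operator kernels of symbol correspondences. $W$ is Stratonovich-Weyl if $\langle W_{A_1}|W_{A_2}\rangle=\langle A_1|A_2\rangle_{\boldsymbol p}$ for all $A_1,A_2$. The antipodal correspondence of $W:\mathcal B(\mathcal H_{\boldsymbol p})\to C^\infty_{\mathbb C}(\mathbb CP^2)$ is $\check W:\mathcal B(\mathcal H_{\check{\boldsymbol p}})\to C^\infty_{\mathbb C}(\mathbb CP^2)$ given by $\check W_{A^*}=W_A$. The symmetric Berezin correspondence for $(p,0)$ is the symbol correspondence whose operator kernel is the orthogonal projector onto the highest weight space of $\mathcal H_{(p,0)}$; the one for $(0,p)$ is that whose operator kernel is the orthogonal projector onto the lowest weight space of $\mathcal H_{(0,p)}$ (both are operator kernels). Every connected component of $\mathcal M_{\boldsymbol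 p}(\mathbb CP^2)$ (which is homeomorphic to $(\mathbb R^\times)^p$) contains the kernel of exactly one Stratonovich-Weyl correspondence; the symmetric Stratonovich-Weyl correspondence for $\boldsymbol p$ is the one in the same connected component as the symmetric Berezin correspondence for $\boldsymbol p$. *)

theory Defs
  imports "HOL-Analysis.Analysis"
begin

section \<open>The group SU(3)\<close>

definition dagger :: "complex^'n^'m \<Rightarrow> complex^'m^'n" where
  "dagger A = map_matrix cnj (transpose A)"

definition unitary :: "complex^'n^'n \<Rightarrow> bool" where
  "unitary U \<longleftrightarrow> dagger U ** U = mat 1 \<and> U ** dagger U = mat 1"

definition SU3 :: "(complex^3^3) set" where
  "SU3 = {g. unitary g \<and> det g = 1}"

definition diag :: "complex^3 \<Rightarrow> complex^3^3" where
  "diag t = (\<chi> i j. if i = j then t $ i else 0)"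

definition matrix_unit :: "3 \<Rightarrow> 3 \<Rightarrow> complex^3^3" where
  "matrix_unit i j = (\<chi> k l. if k = i \<and> l = j then 1 else 0)"

text \<open>Rows and columns are numbered 1, 2, 3 as usual, but in the type \<open>3\<close> the numeral 3 is
  equal to 0, so that the order of that type is not the one meant by ``upper triangular''.
  The positions of the strictly upper triangular matrices are therefore listed.\<close>

definition upper_positions :: "(3 \<times> 3) set" where
  "upper_positions = {(1, 2), (2, 3), (1, 3)}"

definition mat_exp :: "complex^3^3 \<Rightarrow> complex^3^3" where
  "mat_exp X = (\<Sum>k. (1 / fact k) *\<^sub>R (((\<lambda>Y. X ** Y) ^^ k) (mat 1)))"


section \<open>Unitary irreducible representations and their weights\<close>

text \<open>A finite-dimensional complex Hilbert space is identified with \<open>complex^'n\<close>, with its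
  standard Hermitian product, by an orthonormal basis. The values of a representation outside
  \<^const>\<open>SU3\<close> are irrelevant.\<close>

definition unitary_rep :: "(complex^3^3 \<Rightarrow> complex^'n^'n) \<Rightarrow> bool" where
  "unitary_rep \<rho> \<longleftrightarrow>
     continuous_on SU3 \<rho> \<and>
     (\<forall>g\<in>SU3. unitary (\<rho> g)) \<and>
     (\<forall>g\<in>SU3. \<forall>h\<in>SU3. \<rho> (g ** h) = \<rho> g ** \<rho> h)"

definition irreducible_rep :: "(complex^3^3 \<Rightarrow> complex^'n^'n) \<Rightarrow> bool" where
  "irreducible_rep \<rho> \<longleftrightarrow>
     (\<forall>S. vec.subspace S \<and> (\<forall>g\<in>SU3. \<forall>v\<in>S. \<rho> g *v v \<in> S) \<longrightarrow> S = {0} \<or> S = UNIV)"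

text \<open>\<open>derived_rep \<rho> Z D\<close>: the complexified derived representation sends the traceless matrix
  \<open>Z\<close> to \<open>D\<close>. Here \<open>Z = X + \<i> Y\<close> with \<open>X = (Z - Z\<^sup>\<dagger>) / 2\<close> and \<open>Y = (Z + Z\<^sup>\<dagger>) / (2 \<i>)\<close> in the
  Lie algebra of SU(3), and \<open>mat c ** A\<close> is the scalar multiple \<open>c A\<close>.\<close>

definition derived_rep ::
    "(complex^3^3 \<Rightarrow> complex^'n^'n) \<Rightarrow> complex^3^3 \<Rightarrow> complex^'n^'n \<Rightarrow> bool" where
  "derived_rep \<rho> Z D \<longleftrightarrow>
     (let X = mat (1 / 2) ** (Z - dagger Z);
          Y = mat (1 / (2 * \<i>)) ** (Z + dagger Z)
      in \<exists>D\<^sub>X D\<^sub>Y.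
           ((\<lambda>t. \<rho> (mat_exp (t *\<^sub>R X))) has_vector_derivative D\<^sub>X) (at 0) \<and>
           ((\<lambda>t. \<rho> (mat_exp (t *\<^sub>R Y))) has_vector_derivative D\<^sub>Y) (at 0) \<and>
           D = D\<^sub>X + mat \<i> ** D\<^sub>Y)"

definition annihilates ::
    "(complex^3^3 \<Rightarrow> complex^'n^'n) \<Rightarrow> complex^3^3 \<Rightarrow> complex^'n \<Rightarrow> bool" where
  "annihilates \<rho> Z v \<longleftrightarrow> (\<exists>D. derived_rep \<rho> Z D \<and> D *v v = 0)"

text \<open>The weight \<open>a \<varpi>\<^sub>1 + b \<varpi>\<^sub>2\<close>: the fundamental weights are the characters
  \<open>diag (t\<^sub>1, t\<^sub>2, t\<^sub>3) \<mapsto> t\<^sub>1\<close> and \<open>diag (t\<^sub>1, t\<^sub>2, t\<^sub>3) \<mapsto> t\<^sub>1 t\<^sub>2\<close> of the diagonal torus.\<close>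

definition weight_space ::
    "(complex^3^3 \<Rightarrow> complex^'n^'n) \<Rightarrow> int \<times> int \<Rightarrow> (complex^'n) set" where
  "weight_space \<rho> = (\<lambda>(a, b).
     {v. \<forall>t. diag t \<in> SU3 \<longrightarrow> \<rho> (diag t) *v v = ((t $ 1) powi a * (t $ 1 * t $ 2) powi b) *s v})"

definition highest_weight_space :: "(complex^3^3 \<Rightarrow> complex^'n^'n) \<Rightarrow> (complex^'n) set" where
  "highest_weight_space \<rho> =
     {v. (\<exists>\<mu>. v \<in> weight_space \<rho> \<mu>) \<and>
         (\<forall>(i, j)\<in>upper_positions. annihilates \<rho> (matrix_unit i j) v)}"

definition lowest_weight_space :: "(complex^3^3 \<Rightarrow> complex^'n^'n) \<Rightarrow> (complex^'n) set" where
  "lowest_weight_space \<rho> =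
     {v. (\<exists>\<mu>. v \<in> weight_space \<rho> \<mu>) \<and>
         (\<forall>(i, j)\<in>upper_positions. annihilates \<rho> (matrix_unit j i) v)}"

definition irrep_with_highest_weight ::
    "nat \<times> nat \<Rightarrow> (complex^3^3 \<Rightarrow> complex^'n^'n) \<Rightarrow> bool" where
  "irrep_with_highest_weight = (\<lambda>(p, q) \<rho>.
     unitary_rep \<rho> \<and> irreducible_rep \<rho> \<and>
     (\<exists>v. v \<noteq> 0 \<and> v \<in> highest_weight_space \<rho> \<and> v \<in> weight_space \<rho> (int p, int q)))"

text \<open>The dual space is identified with \<open>complex^'n\<close> by the dual basis. The adjoint (transpose)
  \<open>\<phi> \<mapsto> \<phi> \<circ> A\<close> of an operator is then the transposed matrix, and the dual representation is
  \<open>g \<cdot> \<phi> = \<phi> \<circ> \<rho> (g\<^sup>-\<^sup>1)\<close>.\<close>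

definition dual_rep :: "(complex^3^3 \<Rightarrow> complex^'n^'n) \<Rightarrow> complex^3^3 \<Rightarrow> complex^'n^'n" where
  "dual_rep \<rho> g = transpose (\<rho> (matrix_inv g))"

definition dual_weight :: "nat \<times> nat \<Rightarrow> nat \<times> nat" where
  "dual_weight = (\<lambda>(p, q). (q, p))"

definition op_act ::
    "(complex^3^3 \<Rightarrow> complex^'n^'n) \<Rightarrow> complex^3^3 \<Rightarrow> complex^'n^'n \<Rightarrow> complex^'n^'n" where
  "op_act \<rho> g A = \<rho> g ** A ** matrix_inv (\<rho> g)"

definition op_inner :: "complex^'n^'n \<Rightarrow> complex^'n^'n \<Rightarrow> complex" where
  "op_inner A\<^sub>1 A\<^sub>2 = trace (dagger A\<^sub>1 ** A\<^sub>2) / of_nat CARD('n)"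

definition orthogonal_projector_onto :: "(complex^'n) set \<Rightarrow> complex^'n^'n \<Rightarrow> bool" where
  "orthogonal_projector_onto S P \<longleftrightarrow> P ** P = P \<and> dagger P = P \<and> range (\<lambda>v. P *v v) = S"


section \<open>The complex projective plane\<close>

typedef cp2 = "{L. \<exists>z :: complex^3. z \<noteq> 0 \<and> L = range (\<lambda>c. c *s z)}"
  by (auto intro: exI[of _ "1 :: complex^3"])

text \<open>\<open>homog z\<close> is the point with homogeneous coordinates \<open>z \<noteq> 0\<close>; it is meaningless at 0.\<close>

definition homog :: "complex^3 \<Rightarrow> cp2" where
  "homog z = Abs_cp2 (range (\<lambda>c. c *s z))"

definition cp2_act :: "complex^3^3 \<Rightarrow> cp2 \<Rightarrow> cp2" where
  "cp2_act g x = Abs_cp2 ((\<lambda>v. g *v v) ` Rep_cp2 x)"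

definition x0 :: cp2 where
  "x0 = homog (axis 1 1)"

definition isotropy_group :: "(complex^3^3) set" where
  "isotropy_group = {g \<in> SU3. cp2_act g x0 = x0}"

text \<open>Infinite (real) differentiability on an open set, by iterated directional derivatives.\<close>

primrec Ck_on ::
    "nat \<Rightarrow> ('a::euclidean_space \<Rightarrow> 'b::real_normed_vector) \<Rightarrow> 'a set \<Rightarrow> bool" where
  "Ck_on 0 f S \<longleftrightarrow> continuous_on S f"
| "Ck_on (Suc k) f S \<longleftrightarrow>
     f differentiable_on S \<and> (\<forall>v. Ck_on k (\<lambda>x. frechet_derivative f (at x) v) S)"

text \<open>The projection from the nonzero vectors to the projective plane is a surjective submersion,
  so a function is smooth iff its lift is.\<close>

definition smooth_cp2 :: "(cp2 \<Rightarrow> complex) \<Rightarrow> bool" where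
  "smooth_cp2 f \<longleftrightarrow> (\<forall>k. Ck_on k (\<lambda>z. f (homog z)) (- {0}))"

text \<open>The invariant probability measure on the projective plane is the image under
  \<^const>\<open>homog\<close> of the uniform distribution on the unit ball, which is invariant under unitary
  matrices.\<close>

definition cp2_integral :: "(cp2 \<Rightarrow> complex) \<Rightarrow> complex" where
  "cp2_integral f = (LINT z | uniform_measure lborel (ball (0 :: complex^3) 1). f (homog z))"

definition cp2_inner :: "(cp2 \<Rightarrow> complex) \<Rightarrow> (cp2 \<Rightarrow> complex) \<Rightarrow> complex" where
  "cp2_inner f\<^sub>1 f\<^sub>2 = cp2_integral (\<lambda>x. cnj (f\<^sub>1 x) * f\<^sub>2 x)"


section \<open>Symbol correspondences\<close>

definition symbol_correspondence ::
    "(complex^3^3 \<Rightarrow> complex^'n^'n) \<Rightarrow> (complex^'n^'n \<Rightarrow> cp2 \<Rightarrow> complex) \<Rightarrow> bool" where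
  "symbol_correspondence \<rho> W \<longleftrightarrow>
     (\<forall>A. smooth_cp2 (W A)) \<and>
     (\<forall>A B x. W (A + B) x = W A x + W B x) \<and>
     (\<forall>c A x. W (mat c ** A) x = c * W A x) \<and>
     inj W \<and>
     (\<forall>g\<in>SU3. \<forall>A x. W (op_act \<rho> g A) x = W A (cp2_act (matrix_inv g) x)) \<and>
     (\<forall>A x. W (dagger A) x = cnj (W A x)) \<and>
     (\<forall>A. cp2_integral (W A) = trace A / of_nat CARD('n))"

definition operator_kernel ::
    "(complex^3^3 \<Rightarrow> complex^'n^'n) \<Rightarrow> (complex^'n^'n \<Rightarrow> cp2 \<Rightarrow> complex) \<Rightarrow> complex^'n^'n \<Rightarrow> bool"
  where
  "operator_kernel \<rho> W K \<longleftrightarrow>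
     (\<forall>h\<in>isotropy_group. op_act \<rho> h K = K) \<and>
     (\<forall>A. \<forall>g\<in>SU3. W A (cp2_act g x0) = trace (A ** op_act \<rho> g K))"

definition moduli_space :: "(complex^3^3 \<Rightarrow> complex^'n^'n) \<Rightarrow> (complex^'n^'n) set" where
  "moduli_space \<rho> = {K. \<exists>W. symbol_correspondence \<rho> W \<and> operator_kernel \<rho> W K}"

definition stratonovich_weyl ::
    "(complex^3^3 \<Rightarrow> complex^'n^'n) \<Rightarrow> (complex^'n^'n \<Rightarrow> cp2 \<Rightarrow> complex) \<Rightarrow> bool" where
  "stratonovich_weyl \<rho> W \<longleftrightarrow>
     symbol_correspondence \<rho> W \<and> (\<forall>A\<^sub>1 A\<^sub>2. cp2_inner (W A\<^sub>1) (W A\<^sub>2) = op_inner A\<^sub>1 A\<^sub>2)"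

text \<open>\<open>antipodal W W'\<close>: the correspondence \<open>W'\<close> on the operators of the dual space is the antipodal
  correspondence of \<open>W\<close>.\<close>

definition antipodal ::
    "(complex^'n^'n \<Rightarrow> cp2 \<Rightarrow> complex) \<Rightarrow> (complex^'n^'n \<Rightarrow> cp2 \<Rightarrow> complex) \<Rightarrow> bool" where
  "antipodal W W' \<longleftrightarrow> (\<forall>A. W' (transpose A) = W A)"

text \<open>For the weight \<open>(p, 0)\<close> the kernel is the highest weight projector and for \<open>(0, p)\<close> the lowest
  weight projector; there is no symmetric Berezin correspondence for other weights. (For the
  trivial representation the two projectors coincide.)\<close>

definition symmetric_berezin ::
    "nat \<times> nat \<Rightarrow> (complex^3^3 \<Rightarrow> complex^'n^'n) \<Rightarrow> (complex^'n^'n \<Rightarrow> cp2 \<Rightarrow> complex) \<Rightarrow> bool"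
  where
  "symmetric_berezin pq \<rho> W \<longleftrightarrow>
     irrep_with_highest_weight pq \<rho> \<and>
     symbol_correspondence \<rho> W \<and>
     (\<exists>K. operator_kernel \<rho> W K \<and>
        (snd pq = 0 \<and> orthogonal_projector_onto (highest_weight_space \<rho>) K \<or>
         fst pq = 0 \<and> orthogonal_projector_onto (lowest_weight_space \<rho>) K))"

definition sw_in_berezin_component ::
    "nat \<times> nat \<Rightarrow> (complex^3^3 \<Rightarrow> complex^'n^'n) \<Rightarrow> (complex^'n^'n \<Rightarrow> cp2 \<Rightarrow> complex) \<Rightarrow> bool"
  where
  "sw_in_berezin_component pq \<rho> W \<longleftrightarrow>
     stratonovich_weyl \<rho> W \<and>
     (\<exists>B K\<^sub>B K. symmetric_berezin pq \<rho> B \<and> operator_kernel \<rho> B K\<^sub>B \<and> operator_kernel \<rho> W K \<and>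
        connected_component (moduli_space \<rho>) K\<^sub>B K)"

text \<open>\<open>W\<close> is \<^emph>\<open>the\<close> Stratonovich-Weyl correspondence in the connected component of the symmetric
  Berezin correspondence.\<close>

definition symmetric_stratonovich_weyl ::
    "nat \<times> nat \<Rightarrow> (complex^3^3 \<Rightarrow> complex^'n^'n) \<Rightarrow> (complex^'n^'n \<Rightarrow> cp2 \<Rightarrow> complex) \<Rightarrow> bool"
  where
  "symmetric_stratonovich_weyl pq \<rho> W \<longleftrightarrow>
     sw_in_berezin_component pq \<rho> W \<and> (\<forall>V. sw_in_berezin_component pq \<rho> V \<longrightarrow> V = W)"

end

theory Submission
  imports Defs
begin

text \<open>Transposition of operators carries every ingredient of the two constructions for \<open>\<rho>\<close> to the
  corresponding one for the dual representation: kernels, moduli spaces and the inner product, and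
  also the extremal weight spaces, because on matrices the dual of \<open>\<rho>\<close> is its complex conjugate and
  conjugation negates weights and exchanges raising with lowering operators. Applying \<open>\<rho>\<close> of a
  representative of the longest Weyl group element to a highest weight vector gives a lowest weight
  vector, whose conjugate shows that the dual representation has the dual highest weight. Since
  SU(3) is transitive on the projective plane, a correspondence is determined by its kernel, which
  settles the Berezin case; the Stratonovich-Weyl case follows because transposition is a
  homeomorphism of the moduli spaces.\<close>

section \<open>Entrywise calculus of transposes, conjugates and adjoints\<close>

lemma mat_mult_nth [simp]:
  fixes A :: "'a::semiring_1^'n^'m"
  shows "(mat c ** A) $ i $ j = c * A $ i $ j"
  by (simp add: matrix_matrix_mult_def mat_def if_distrib[where f="\<lambda>x. x * _"] cong: if_cong)

definition cnj_vec :: "complex^'n \<Rightarrow> complex^'n" where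
  "cnj_vec v = (\<chi> i. cnj (v $ i))"

abbreviation cnj_mat :: "complex^'n^'m \<Rightarrow> complex^'n^'m" where
  "cnj_mat \<equiv> map_matrix cnj"

lemma mat_nth: "mat c $ i $ j = (if i = j then c else 0)"
  by (simp add: mat_def)

lemma map_matrix_nth [simp]: "map_matrix f A $ i $ j = f (A $ i $ j)"
  by (simp add: map_matrix_def)

lemma transpose_nth [simp]: "transpose A $ i $ j = A $ j $ i"
  by (simp add: transpose_def)

lemma dagger_nth [simp]: "dagger A $ i $ j = cnj (A $ j $ i)"
  by (simp add: dagger_def)

lemma cnj_vec_nth [simp]: "cnj_vec v $ i = cnj (v $ i)"
  by (simp add: cnj_vec_def)

lemma cnj_vec_cnj_vec [simp]: "cnj_vec (cnj_vec v) = v"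
  by (simp add: vec_eq_iff)

lemma cnj_vec_eq_0_iff [simp]: "cnj_vec v = 0 \<longleftrightarrow> v = 0"
  by (simp add: vec_eq_iff)

lemma cnj_vec_zero [simp]: "cnj_vec 0 = 0"
  by simp

lemma cnj_vec_add: "cnj_vec (v + w) = cnj_vec v + cnj_vec w"
  by (simp add: vec_eq_iff)

lemma cnj_vec_scale: "cnj_vec (c *s v) = cnj c *s cnj_vec v"
  by (simp add: vec_eq_iff)

lemma cnj_mat_cnj_mat [simp]: "cnj_mat (cnj_mat A) = A"
  by (simp add: vec_eq_iff)

lemma cnj_mat_mult: "cnj_mat (A ** B) = cnj_mat A ** cnj_mat B"
  by (simp add: vec_eq_iff matrix_matrix_mult_def)

lemma cnj_mat_mult_vec: "cnj_vec (A *v v) = cnj_mat A *v cnj_vec v"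
  by (simp add: vec_eq_iff matrix_vector_mult_def)

lemma cnj_mat_mat [simp]: "cnj_mat (mat c) = mat (cnj c)"
  by (simp add: vec_eq_iff mat_def)

lemma dagger_mult: "dagger (A ** B) = dagger B ** dagger A"
  by (simp add: vec_eq_iff matrix_matrix_mult_def mult.commute)

lemma dagger_cnj_mat: "dagger (cnj_mat A) = transpose A"
  by (simp add: vec_eq_iff)

lemma transpose_dagger: "transpose (dagger A) = cnj_mat A"
  by (simp add: vec_eq_iff)

lemma dagger_transpose: "dagger (transpose A) = transpose (dagger A)"
  by (simp add: vec_eq_iff)

lemma trace_transpose: "trace (transpose A) = trace A"
  by (simp add: trace_def)

lemma transpose_mat_mult: "transpose (mat c ** A) = mat c ** transpose (A :: complex^'n^'m)"
  by (simp add: vec_eq_iff)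

lemma bounded_linear_cnj_mat: "bounded_linear (cnj_mat :: complex^'n^'m \<Rightarrow> _)"
  unfolding linear_conv_bounded_linear[symmetric]
  by (rule linearI) (simp_all add: vec_eq_iff)

lemma bounded_linear_transpose: "bounded_linear (transpose :: complex^'n^'m \<Rightarrow> _)"
  unfolding linear_conv_bounded_linear[symmetric]
  by (rule linearI) (simp_all add: vec_eq_iff)

lemma bounded_linear_matrix_sandwich:
  "bounded_linear (\<lambda>X :: complex^'n^'m. (A :: complex^'m^'k) ** X ** (B :: complex^'l^'n))"
  unfolding linear_conv_bounded_linear[symmetric]
  by (rule linearI)
    (simp_all add: vec_eq_iff matrix_matrix_mult_def sum.distrib algebra_simps scaleR_sum_right
       sum_distrib_left sum_distrib_right)

lemma unitary_cnj_mat: "unitary U \<Longrightarrow> unitary (cnj_mat U)"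
proof -
  assume U: "unitary U"
  have "cnj_mat (dagger U ** U) = mat 1" "cnj_mat (U ** dagger U) = mat 1"
    using U by (simp_all add: unitary_def)
  moreover have "cnj_mat (dagger U) = dagger (cnj_mat U)" by (simp add: vec_eq_iff)
  ultimately show ?thesis by (simp add: unitary_def cnj_mat_mult)
qed

section \<open>Inverses and orthogonal projectors\<close>

lemma matrix_inv_unique:
  fixes A :: "complex^'n^'n"
  assumes "A ** B = mat 1" "B ** A = mat 1"
  shows "matrix_inv A = B"
proof -
  have "A ** matrix_inv A = mat 1 \<and> matrix_inv A ** A = mat 1"
    unfolding matrix_inv_def by (rule someI[of _ B]) (use assms in simp)
  then have "matrix_inv A = matrix_inv A ** (A ** B)" "matrix_inv A ** A = mat 1"
    using assms by simp_all
  then show ?thesis by (simp add: matrix_mul_assoc)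
qed

lemma unitary_matrix_inv: "unitary U \<Longrightarrow> matrix_inv U = dagger U"
  by (rule matrix_inv_unique) (auto simp: unitary_def)

lemma unitaryI:
  fixes U :: "complex^'n^'n"
  assumes "dagger U ** U = mat 1"
  shows "unitary U"
  using assms matrix_left_right_inverse unfolding unitary_def by blast

text \<open>Projectors with the same range absorb each other: PQ = Q and QP = P. The adjoint of the
  first identity is Q = QP, hence Q = P.\<close>

lemma orthogonal_projector_onto_unique:
  assumes "orthogonal_projector_onto S P" "orthogonal_projector_onto S Q"
  shows "P = Q"
proof -
  have absorb: "A ** B = B" if "orthogonal_projector_onto S A" "orthogonal_projector_onto S B"
    for A B :: "complex^'a^'a"
  proof -
    have "A *v (B *v v) = B *v v" for v
    proof -
      have "B *v v \<in> range (\<lambda>v. A *v v)"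
        using that unfolding orthogonal_projector_onto_def by blast
      then obtain u where "B *v v = A *v u" by blast
      then show ?thesis
        using that(1) by (simp add: orthogonal_projector_onto_def matrix_vector_mul_assoc)
    qed
    then show ?thesis
      by (simp add: matrix_eq matrix_vector_mul_assoc)
  qed
  have "Q = dagger Q" using assms(2) by (simp add: orthogonal_projector_onto_def)
  also have "\<dots> = dagger (P ** Q)" using absorb[OF assms] by simp
  also have "\<dots> = Q ** P"
    using assms by (simp add: dagger_mult orthogonal_projector_onto_def)
  also have "\<dots> = P" using absorb assms by blast
  finally show ?thesis by simp
qed

text \<open>For self-adjoint P the transpose is the entrywise conjugate, which is P conjugated by
  the bijection \<open>cnj_vec\<close>; hence the conjugated range.\<close>

lemma orthogonal_projector_onto_transpose:
  assumes "orthogonal_projector_onto S P"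
  shows "orthogonal_projector_onto (cnj_vec ` S) (transpose P)"
proof -
  have P: "P ** P = P" "dagger P = P" "range (\<lambda>v. P *v v) = S"
    using assms by (auto simp: orthogonal_projector_onto_def)
  have T: "transpose P = cnj_mat P" using P(2) transpose_dagger by metis
  have "(\<lambda>v. transpose P *v v) = cnj_vec \<circ> (\<lambda>v. P *v v) \<circ> cnj_vec"
    by (rule ext) (simp add: T cnj_mat_mult_vec del: vector_transpose_matrix)
  moreover have "surj (cnj_vec :: complex^'a \<Rightarrow> _)" by (metis cnj_vec_cnj_vec surjI)
  ultimately have "range (\<lambda>v. transpose P *v v) = cnj_vec ` S"
    by (simp only: image_comp[symmetric] P(3))
  moreover have "transpose P ** transpose P = transpose P"
    using P(1) by (metis matrix_transpose_mul)
  ultimately show ?thesis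
    using P(2) by (simp add: orthogonal_projector_onto_def dagger_transpose)
qed

section \<open>Exponentials of root vectors\<close>

text \<open>The skew-Hermitian parts of a root vector have the eigenvalues 0 and \<open>\<plusminus>\<i>/2\<close>, which is the source
  of the cubic relation.\<close>

lemma mat_exp_cubic:
  assumes cube: "X ** (X ** X) = (- 1 / 4) *\<^sub>R X"
  shows "mat_exp (t *\<^sub>R X) =
    mat 1 + (2 * sin (t / 2)) *\<^sub>R X + (4 * (1 - cos (t / 2))) *\<^sub>R (X ** X)"
proof -
  \<comment> \<open>\<open>s\<close> and \<open>c\<close> are the terms of the sine and cosine
    series at t/2, \<open>z\<close> those of the constant 1. Then \<open>a\<close> is the claimed
    k-th term of the exponential series.\<close>
  define s where "s k = sin_coeff k * (t / 2) ^ k" for k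
  define c where "c k = cos_coeff k * (t / 2) ^ k" for k
  define z :: "nat \<Rightarrow> real" where "z k = 0 ^ k" for k
  define a where "a k = z k *\<^sub>R mat 1 + (2 * s k) *\<^sub>R X + (4 * (z k - c k)) *\<^sub>R (X ** X)" for k
  have Suc_s: "2 * s (Suc k) = t * c k / real (Suc k)" for k
    by (simp add: s_def c_def sin_coeff_Suc del: of_nat_Suc)
  have Suc_c: "4 * c (Suc k) = - (2 * t * s k) / real (Suc k)" for k
    by (simp add: s_def c_def cos_coeff_Suc del: of_nat_Suc)
  \<comment> \<open>The cubic relation folds the third power of X back onto X, where the two
    contributions of \<open>z\<close> cancel.\<close>
  have mult_a: "X ** a k = c k *\<^sub>R X + (2 * s k) *\<^sub>R (X ** X)" for k
  proof -
    have "X ** a k = z k *\<^sub>R X + (2 * s k) *\<^sub>R (X ** X) + (4 * (z k - c k)) *\<^sub>R ((- 1 / 4) *\<^sub>R X)"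
      unfolding a_def cube[symmetric]
      by (simp only: matrix_add_ldistrib matrix_scalar_ac scalar_matrix_assoc[symmetric]
          matrix_mul_rid)
    moreover have "4 * (z k - c k) * (- 1 / 4) = c k - z k" by (simp add: field_simps)
    ultimately show ?thesis by (simp only: scaleR_scaleR scaleR_diff_left) simp
  qed
  have summand: "(1 / fact k) *\<^sub>R (((\<lambda>Y. (t *\<^sub>R X) ** Y) ^^ k) (mat 1)) = a k" for k
  proof (induction k)
    case 0
    show ?case by (simp add: a_def s_def c_def z_def)
  next
    case (Suc k)
    have "(1 / fact (Suc k)) *\<^sub>R (((\<lambda>Y. (t *\<^sub>R X) ** Y) ^^ Suc k) (mat 1)) =
      (t / real (Suc k)) *\<^sub>R (X ** ((1 / fact k) *\<^sub>R (((\<lambda>Y. (t *\<^sub>R X) ** Y) ^^ k) (mat 1))))"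
      by (simp add: matrix_scalar_ac scalar_matrix_assoc[symmetric] field_simps)
    also have "\<dots> = (t / real (Suc k)) *\<^sub>R (c k *\<^sub>R X + (2 * s k) *\<^sub>R (X ** X))"
      unfolding Suc.IH mult_a ..
    also have "\<dots> = a (Suc k)"
    proof -
      have "4 * (z (Suc k) - c (Suc k)) = (t / real (Suc k)) * (2 * s k)"
        using Suc_c[of k] by (simp add: z_def)
      moreover have "2 * s (Suc k) = (t / real (Suc k)) * c k" using Suc_s[of k] by simp
      moreover have "z (Suc k) = 0" by (simp add: z_def)
      ultimately show ?thesis unfolding a_def by (simp only: scaleR_add_right scaleR_scaleR) simp
    qed
    finally show ?case .
  qed
  have "s sums sin (t / 2)"
    using sin_converges[of "t / 2"] by (simp add: s_def[abs_def])
  moreover have "c sums cos (t / 2)"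
    using cos_converges[of "t / 2"] by (simp add: c_def[abs_def])
  moreover have "z sums 1"
    unfolding z_def using powser_sums_zero[of "\<lambda>_. 1 :: real"] by simp
  ultimately have "a sums (1 *\<^sub>R mat 1 + (2 * sin (t / 2)) *\<^sub>R X + (4 * (1 - cos (t / 2))) *\<^sub>R (X ** X))"
    unfolding a_def by (intro sums_add sums_scaleR_left sums_mult sums_diff)
  then show ?thesis
    unfolding mat_exp_def summand using sums_unique by fastforce
qed

abbreviation skew_part :: "complex^3^3 \<Rightarrow> complex^3^3" where
  "skew_part Z \<equiv> mat (1 / 2) ** (Z - dagger Z)"

text \<open>Despite the name this matrix is skew-Hermitian: it is the Hermitian part of Z divided by
  \<i>. Both abbreviations repeat the terms X and Y of \<open>derived_rep\<close>.\<close>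

abbreviation herm_part :: "complex^3^3 \<Rightarrow> complex^3^3" where
  "herm_part Z \<equiv> mat (1 / (2 * \<i>)) ** (Z + dagger Z)"

lemma dagger_matrix_unit: "dagger (matrix_unit i j) = matrix_unit j i"
  by (auto simp: vec_eq_iff matrix_unit_def)

text \<open>The shape with coefficients \<alpha> and \<beta> covers \<open>skew_part\<close> and
  \<open>herm_part\<close> of a matrix unit alike, so the computations are done once for
  both.\<close>

lemma root_vector_nth:
  assumes "i \<noteq> j" "X = mat \<alpha> ** matrix_unit i j + mat \<beta> ** matrix_unit j i"
  shows "X $ k $ l = (if k = i \<and> l = j then \<alpha> else if k = j \<and> l = i then \<beta> else 0)"
  using assms by (simp add: matrix_unit_def)

text \<open>X exchanges the coordinate lines i and j up to the factors \<alpha> and \<beta> and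
  kills the third, so its square is \<alpha>\<beta> on their span.\<close>

lemma root_vector_square:
  assumes "i \<noteq> j" "\<alpha> * \<beta> = - 1 / 4"
    and X: "X = mat \<alpha> ** matrix_unit i j + mat \<beta> ** matrix_unit j i"
  shows "(X ** X) $ k $ l = (if k = l \<and> (k = i \<or> k = j) then - 1 / 4 else 0)"
proof -
  have "\<beta> * \<alpha> = - 1 / 4" using assms(2) by (simp add: mult.commute)
  then show ?thesis
    using exhaust_3[of i] exhaust_3[of j] exhaust_3[of k] exhaust_3[of l] assms(1,2)
    by (elim disjE) (simp_all add: matrix_matrix_mult_def sum_3 root_vector_nth[OF assms(1) X])
qed

text \<open>X maps into the coordinate plane of i and j, where its square is the scalar
  -1/4.\<close>

lemma root_vector_cube:
  assumes "i \<noteq> j" "\<alpha> * \<beta> = - 1 / 4"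
    and X: "X = mat \<alpha> ** matrix_unit i j + mat \<beta> ** matrix_unit j i"
  shows "X ** (X ** X) = (- 1 / 4) *\<^sub>R X"
proof -
  have "(\<Sum>m\<in>UNIV. X $ k $ m * (X ** X) $ m $ l) = (- 1 / 4) *\<^sub>R X $ k $ l" for k l
    unfolding root_vector_square[OF assms]
    using assms(1) exhaust_3[of i] exhaust_3[of j] exhaust_3[of l]
    by (elim disjE) (simp_all add: sum_3 root_vector_nth[OF assms(1) X]
          scaleR_conv_of_real[where 'a = complex])
  then show ?thesis by (simp add: vec_eq_iff matrix_matrix_mult_def[of X "X ** X"])
qed

text \<open>In the coordinates i, j the exponential is the SU(2) matrix with rows (C, a) and (-cnj
  a, C); it fixes the third coordinate. The modulus of \<alpha> is 1/2, so a has squared modulus S *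
  S = 1 - C * C.\<close>

lemma mat_exp_root_vector_in_SU3:
  assumes "i \<noteq> j" "\<alpha> * \<beta> = - 1 / 4" "\<beta> = - cnj \<alpha>"
    and X: "X = mat \<alpha> ** matrix_unit i j + mat \<beta> ** matrix_unit j i"
  shows "mat_exp (t *\<^sub>R X) \<in> SU3"
proof -
  define S C where "S = complex_of_real (sin (t / 2))" and "C = complex_of_real (cos (t / 2))"
  define U where "U = mat_exp (t *\<^sub>R X)"
  have SC: "S * S = 1 - C * C"
  proof -
    have "sin (t / 2) * sin (t / 2) = 1 - cos (t / 2) * cos (t / 2)"
      using sin_squared_eq[of "t / 2"] by (simp only: power2_eq_square)
    then show ?thesis unfolding S_def C_def by (metis of_real_1 of_real_diff of_real_mult)
  qed
  have ab: "\<alpha> * cnj \<alpha> = 1 / 4"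
    using assms(2) unfolding assms(3) by (metis minus_divide_left minus_equation_iff mult_minus_right)
  have real: "cnj S = S" "cnj C = C" by (simp_all add: S_def C_def)
  define a where "a = 2 * S * \<alpha>"
  have a: "a * cnj a = 1 - C * C"
  proof -
    have "a * cnj a = (2 * 2) * ((S * S) * (\<alpha> * cnj \<alpha>))"
      by (simp only: a_def complex_cnj_mult complex_cnj_numeral real mult_ac)
    also have "\<dots> = 1 - C * C" unfolding ab SC by simp
    finally show ?thesis .
  qed
  then have a': "cnj a * a = 1 - C * C" by (simp add: mult.commute)
  have nth: "U $ k $ l =
      (if k = l then if k = i \<or> k = j then C else 1
       else if k = i \<and> l = j then a else if k = j \<and> l = i then - cnj a else 0)" for k l
  proof -
    have "U $ k $ l = mat 1 $ k $ l + 2 * S * X $ k $ l + 4 * (1 - C) * (X ** X) $ k $ l"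
      unfolding U_def mat_exp_cubic[OF root_vector_cube[OF assms(1,2) X]] S_def C_def
      by (simp add: scaleR_conv_of_real[where 'a = complex])
    then show ?thesis
      unfolding root_vector_square[OF assms(1,2) X] root_vector_nth[OF assms(1) X] mat_nth
      using assms(1) by (simp add: a_def assms(3) real diff_divide_distrib)
  qed
  have "dagger U ** U = mat 1"
    unfolding vec_eq_iff forall_3
    using exhaust_3[of i] exhaust_3[of j] assms(1)
    by (elim disjE) (simp_all add: matrix_matrix_mult_def sum_3 nth mat_nth real a a')
  moreover have "det U = 1"
    using exhaust_3[of i] exhaust_3[of j] assms(1)
    by (elim disjE) (simp_all add: det_3 nth a a')
  ultimately show ?thesis unfolding SU3_def U_def[symmetric] using unitaryI by blast
qed

section \<open>Dual representations\<close>

text \<open>By unitarity, the representation dual to \<open>\<rho>\<close> is the entrywise complex conjugate of \<open>\<rho>\<close> on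
  \<^const>\<open>SU3\<close>. Unlike \<^const>\<open>dual_rep\<close>, this relation is symmetric, so that every transport
  lemma can be used in both directions.\<close>

definition dual_reps ::
    "(complex^3^3 \<Rightarrow> complex^'n^'n) \<Rightarrow> (complex^3^3 \<Rightarrow> complex^'n^'n) \<Rightarrow> bool" where
  "dual_reps \<rho> \<rho>' \<longleftrightarrow>
     unitary_rep \<rho> \<and> unitary_rep \<rho>' \<and> (\<forall>g\<in>SU3. \<rho>' g = cnj_mat (\<rho> g))"

lemma dual_reps_sym: "dual_reps \<rho> \<rho>' \<Longrightarrow> dual_reps \<rho>' \<rho>"
  by (auto simp: dual_reps_def)

section \<open>SU(3) as a group and the conjugate representation\<close>

lemma SU3_mult: "g \<in> SU3 \<Longrightarrow> h \<in> SU3 \<Longrightarrow> g ** h \<in> SU3"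
proof -
  assume "g \<in> SU3" "h \<in> SU3"
  then have "dagger (g ** h) ** (g ** h) = dagger h ** (dagger g ** g) ** h" "det (g ** h) = 1"
    by (simp_all add: dagger_mult matrix_mul_assoc SU3_def det_mul)
  then show ?thesis
    using \<open>g \<in> SU3\<close> \<open>h \<in> SU3\<close> unitaryI[of "g ** h"] by (simp add: SU3_def unitary_def)
qed

lemma SU3_one: "mat 1 \<in> SU3"
  by (simp add: SU3_def unitaryI vec_eq_iff mat_nth dagger_def transpose_mat)

lemma dagger_dagger [simp]: "dagger (dagger A) = A"
  by (simp add: vec_eq_iff)

lemma det_dagger: "det (dagger A) = cnj (det A)"
proof -
  have "det (dagger A) = det (cnj_mat A)"
    by (metis dagger_def det_transpose dagger_transpose transpose_dagger transpose_transpose)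
  also have "\<dots> = cnj (det A)" by (simp add: det_def)
  finally show ?thesis .
qed

lemma SU3_dagger: "g \<in> SU3 \<Longrightarrow> dagger g \<in> SU3"
  by (simp add: SU3_def unitary_def det_dagger)

text \<open>Multiplicativity makes \<open>\<rho> (mat 1)\<close> idempotent, and an invertible
  idempotent is the identity.\<close>

lemma unitary_rep_one:
  assumes "unitary_rep \<rho>"
  shows "\<rho> (mat 1) = mat 1"
proof -
  have u: "dagger (\<rho> (mat 1)) ** \<rho> (mat 1) = mat 1"
    using assms SU3_one by (simp add: unitary_rep_def unitary_def)
  have "\<rho> (mat 1) ** \<rho> (mat 1) = \<rho> (mat 1)"
    using assms SU3_one unfolding unitary_rep_def by (metis matrix_mul_lid)
  then show ?thesis using u by (metis matrix_mul_assoc matrix_mul_lid)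
qed

lemma unitary_rep_dagger:
  assumes "unitary_rep \<rho>" "g \<in> SU3"
  shows "\<rho> (dagger g) = dagger (\<rho> g)"
proof -
  have "\<rho> (dagger g) ** \<rho> g = mat 1"
    using assms SU3_dagger[OF assms(2)] unitary_rep_one[OF assms(1)]
    unfolding unitary_rep_def by (metis (no_types, lifting) SU3_def mem_Collect_eq unitary_def)
  moreover have "\<rho> g ** dagger (\<rho> g) = mat 1"
    using assms by (simp add: unitary_rep_def unitary_def)
  ultimately show ?thesis by (metis matrix_mul_assoc matrix_mul_lid matrix_mul_rid)
qed

text \<open>On SU(3) inverses are adjoints and \<rho> respects adjoints, so the dual representation
  is the transpose of the adjoint of \<open>\<rho> g\<close>, its entrywise conjugate.\<close>

lemma dual_reps_dual_rep:
  assumes "unitary_rep \<rho>"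
  shows "dual_reps \<rho> (dual_rep \<rho>)"
proof -
  have eq: "dual_rep \<rho> g = cnj_mat (\<rho> g)" if "g \<in> SU3" for g
  proof -
    have "matrix_inv g = dagger g" using that by (simp add: SU3_def unitary_matrix_inv)
    then show ?thesis
      by (simp add: dual_rep_def unitary_rep_dagger[OF assms that] transpose_dagger)
  qed
  have "continuous_on SU3 (\<lambda>g. cnj_mat (\<rho> g))"
    using assms bounded_linear.continuous_on[OF bounded_linear_cnj_mat]
    by (auto simp: unitary_rep_def)
  then have "continuous_on SU3 (dual_rep \<rho>)"
    using eq continuous_on_cong by metis
  moreover have "\<forall>g\<in>SU3. unitary (dual_rep \<rho> g)"
    using assms by (simp add: eq unitary_rep_def unitary_cnj_mat)
  moreover have "\<forall>g\<in>SU3. \<forall>h\<in>SU3. dual_rep \<rho> (g ** h) = dual_rep \<rho> g ** dual_rep \<rho> h"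
    using assms by (simp add: eq SU3_mult unitary_rep_def cnj_mat_mult)
  ultimately show ?thesis
    using assms eq by (simp add: dual_reps_def unitary_rep_def)
qed

text \<open>Entrywise conjugation of vectors is a conjugate-linear involution that turns subspaces
  invariant under one representation into subspaces invariant under the other.\<close>

lemma dual_reps_irreducible:
  assumes "dual_reps \<rho> \<rho>'" "irreducible_rep \<rho>"
  shows "irreducible_rep \<rho>'"
  unfolding irreducible_rep_def
proof (intro allI impI)
  fix S
  assume S: "vec.subspace S \<and> (\<forall>g\<in>SU3. \<forall>v\<in>S. \<rho>' g *v v \<in> S)"
  have "vec.subspace (cnj_vec ` S)"
    unfolding vec.subspace_def
  proof (intro conjI ballI allI)
    show "0 \<in> cnj_vec ` S"
      using S vec.subspace_0 cnj_vec_zero by (metis image_eqI)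
  next
    fix x y assume "x \<in> cnj_vec ` S" "y \<in> cnj_vec ` S"
    then show "x + y \<in> cnj_vec ` S"
      using S vec.subspace_add cnj_vec_add by (metis (no_types, lifting) image_iff)
  next
    fix c x assume "x \<in> cnj_vec ` S"
    then obtain v where "v \<in> S" "x = cnj_vec v" by blast
    then show "c *s x \<in> cnj_vec ` S"
      using S vec.subspace_scale[of S v "cnj c"] cnj_vec_scale[of "cnj c" v]
      by (metis complex_cnj_cnj image_eqI)
  qed
  moreover have "\<rho> g *v v \<in> cnj_vec ` S" if "g \<in> SU3" "v \<in> cnj_vec ` S" for g v
  proof -
    have "\<rho> g *v v = cnj_vec (\<rho>' g *v cnj_vec v)"
      using assms(1) that by (simp add: dual_reps_def cnj_mat_mult_vec)
    moreover have "cnj_vec v \<in> S" using that by auto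
    ultimately show ?thesis using S that by blast
  qed
  ultimately have "cnj_vec ` S = {0} \<or> cnj_vec ` S = UNIV"
    using assms(2) unfolding irreducible_rep_def by blast
  moreover have "S = cnj_vec ` cnj_vec ` S" by (simp add: image_image)
  moreover have "range cnj_vec = (UNIV :: (complex^'a) set)" by (metis cnj_vec_cnj_vec surjI)
  ultimately show "S = {0} \<or> S = UNIV" by (metis cnj_vec_zero image_empty image_insert)
qed

section \<open>Derived representations and weights under conjugation\<close>

lemma root_vector_parts:
  "skew_part (matrix_unit i j) = mat (1 / 2) ** matrix_unit i j + mat (- 1 / 2) ** matrix_unit j i"
  "herm_part (matrix_unit i j) =
     mat (1 / (2 * \<i>)) ** matrix_unit i j + mat (1 / (2 * \<i>)) ** matrix_unit j i"
  by (simp_all add: dagger_matrix_unit vec_eq_iff algebra_simps del: mult_minus1_right)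

text \<open>The coefficient pairs (1/2, -1/2) and (1/(2\<i>), 1/(2\<i>)) both have product -1/4, and
  in both the second is minus the conjugate of the first.\<close>

lemma
  assumes "i \<noteq> j"
  shows skew_part_cube:
      "skew_part (matrix_unit i j) ** (skew_part (matrix_unit i j) ** skew_part (matrix_unit i j)) =
      (- 1 / 4) *\<^sub>R skew_part (matrix_unit i j)"
    and herm_part_cube:
      "herm_part (matrix_unit i j) ** (herm_part (matrix_unit i j) ** herm_part (matrix_unit i j)) =
      (- 1 / 4) *\<^sub>R herm_part (matrix_unit i j)"
    and mat_exp_skew_part_in_SU3: "mat_exp (t *\<^sub>R skew_part (matrix_unit i j)) \<in> SU3"
    and mat_exp_herm_part_in_SU3: "mat_exp (t *\<^sub>R herm_part (matrix_unit i j)) \<in> SU3"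
  by (rule root_vector_cube[OF assms _ root_vector_parts(1)]
      root_vector_cube[OF assms _ root_vector_parts(2)]
      mat_exp_root_vector_in_SU3[OF assms _ _ root_vector_parts(1)]
      mat_exp_root_vector_in_SU3[OF assms _ _ root_vector_parts(2)];
      simp add: field_simps)+

text \<open>The adjoint of Z = X + \<i>Y is -X + \<i>Y. Conjugating the two curves conjugates
  \<open>DX\<close> and \<open>DY\<close>, and -cnj DX + \<i> cnj DY is minus the conjugate of DX +
  \<i> DY.\<close>

lemma dual_reps_derived_rep:
  assumes dual: "dual_reps \<rho> \<rho>'" and "i \<noteq> j" and D: "derived_rep \<rho> (matrix_unit i j) D"
  shows "derived_rep \<rho>' (matrix_unit j i) (- cnj_mat D)"
proof -
  define X Y where "X = skew_part (matrix_unit i j)" and "Y = herm_part (matrix_unit i j)"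
  have X': "skew_part (matrix_unit j i) = - X" and Y': "herm_part (matrix_unit j i) = Y"
    by (simp_all add: X_def Y_def dagger_matrix_unit vec_eq_iff algebra_simps)
  obtain DX DY where
    DX: "((\<lambda>t. \<rho> (mat_exp (t *\<^sub>R X))) has_vector_derivative DX) (at 0)" and
    DY: "((\<lambda>t. \<rho> (mat_exp (t *\<^sub>R Y))) has_vector_derivative DY) (at 0)" and
    D_eq: "D = DX + mat \<i> ** DY"
    using D unfolding derived_rep_def Let_def X_def Y_def by blast
  have "((\<lambda>t. \<rho> (mat_exp ((- t) *\<^sub>R X))) has_vector_derivative (- 1) *\<^sub>R DX) (at 0)"
    using vector_diff_chain_at[of uminus "- 1" 0 "\<lambda>t. \<rho> (mat_exp (t *\<^sub>R X))" DX] DX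
    by (simp add: o_def has_vector_derivative_minus has_vector_derivative_id)
  \<comment> \<open>The two representations are related on \<open>SU3\<close> only, so the curves
    must be known to stay in it.\<close>
  moreover have "\<rho>' (mat_exp (t *\<^sub>R (- X))) = cnj_mat (\<rho> (mat_exp ((- t) *\<^sub>R X)))" for t
  proof -
    have "mat_exp ((- t) *\<^sub>R X) \<in> SU3"
      unfolding X_def by (rule mat_exp_skew_part_in_SU3[OF \<open>i \<noteq> j\<close>])
    then show ?thesis using dual by (simp add: dual_reps_def)
  qed
  ultimately have 1: "((\<lambda>t. \<rho>' (mat_exp (t *\<^sub>R (- X)))) has_vector_derivative
      cnj_mat ((- 1) *\<^sub>R DX)) (at 0)"
    by (simp only: bounded_linear.has_vector_derivative[OF bounded_linear_cnj_mat])
  have "\<rho>' (mat_exp (t *\<^sub>R Y)) = cnj_mat (\<rho> (mat_exp (t *\<^sub>R Y)))" for t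
  proof -
    have "mat_exp (t *\<^sub>R Y) \<in> SU3"
      unfolding Y_def by (rule mat_exp_herm_part_in_SU3[OF \<open>i \<noteq> j\<close>])
    then show ?thesis using dual by (simp add: dual_reps_def)
  qed
  then have 2: "((\<lambda>t. \<rho>' (mat_exp (t *\<^sub>R Y))) has_vector_derivative cnj_mat DY) (at 0)"
    by (simp only: bounded_linear.has_vector_derivative[OF bounded_linear_cnj_mat DY])
  have "- cnj_mat D = cnj_mat ((- 1) *\<^sub>R DX) + mat \<i> ** cnj_mat DY"
    by (simp add: D_eq vec_eq_iff)
  then show ?thesis
    unfolding derived_rep_def Let_def X' Y' using 1 2 by blast
qed

lemma dual_reps_annihilates:
  assumes "dual_reps \<rho> \<rho>'" "i \<noteq> j" "annihilates \<rho> (matrix_unit i j) v"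
  shows "annihilates \<rho>' (matrix_unit j i) (cnj_vec v)"
proof -
  obtain D where D: "derived_rep \<rho> (matrix_unit i j) D" "D *v v = 0"
    using assms(3) by (auto simp: annihilates_def)
  have "(- cnj_mat D) *v cnj_vec v = - cnj_vec (D *v v)"
    unfolding cnj_mat_mult_vec by (simp add: vec_eq_iff matrix_vector_mult_def sum_negf)
  then show ?thesis
    using dual_reps_derived_rep[OF assms(1,2) D(1)] D(2) by (auto simp: annihilates_def)
qed

lemma diag_SU3_cnj:
  assumes "diag t \<in> SU3"
  shows "cnj (t $ i) = inverse (t $ i)"
proof -
  have "(dagger (diag t) ** diag t) $ i $ i = 1"
    using assms by (simp add: SU3_def unitary_def mat_nth)
  then have "cnj (t $ i) * t $ i = 1"
    by (simp add: matrix_matrix_mult_def diag_def if_distrib[where f=cnj]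
        if_distrib[where f="\<lambda>x. x * _"] cong: if_cong)
  then show ?thesis by (metis inverse_unique mult.commute)
qed

text \<open>Torus entries have modulus 1, so conjugating a character value inverts it.\<close>

lemma dual_reps_weight_space:
  assumes "dual_reps \<rho> \<rho>'" "v \<in> weight_space \<rho> (a, b)"
  shows "cnj_vec v \<in> weight_space \<rho>' (- a, - b)"
proof -
  have "\<rho>' (diag t) *v cnj_vec v = ((t $ 1) powi (- a) * (t $ 1 * t $ 2) powi (- b)) *s cnj_vec v"
    if t: "diag t \<in> SU3" for t
  proof -
    have "\<rho>' (diag t) *v cnj_vec v = cnj_vec (\<rho> (diag t) *v v)"
      using assms(1) t by (simp add: dual_reps_def cnj_mat_mult_vec)
    also have "\<dots> = cnj ((t $ 1) powi a * (t $ 1 * t $ 2) powi b) *s cnj_vec v"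
      using assms(2) t by (simp add: weight_space_def cnj_vec_scale)
    also have "cnj ((t $ 1) powi a * (t $ 1 * t $ 2) powi b) =
        (t $ 1) powi (- a) * (t $ 1 * t $ 2) powi (- b)"
      using diag_SU3_cnj[OF t, of 1] diag_SU3_cnj[OF t, of 2]
      by (simp add: power_int_minus power_int_inverse power_int_mult_distrib)
    finally show ?thesis .
  qed
  then show ?thesis by (simp add: weight_space_def)
qed

text \<open>Conjugation replaces each root vector by its adjoint, so vectors killed by the raising
  operators become vectors killed by the lowering ones.\<close>

lemma dual_reps_highest_weight_space:
  assumes dual: "dual_reps \<rho> \<rho>'" and v: "v \<in> highest_weight_space \<rho>"
  shows "cnj_vec v \<in> lowest_weight_space \<rho>'"
proof -
  obtain a b where "v \<in> weight_space \<rho> (a, b)"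
    using v by (auto simp: highest_weight_space_def)
  then have "cnj_vec v \<in> weight_space \<rho>' (- a, - b)"
    by (rule dual_reps_weight_space[OF dual])
  moreover have "annihilates \<rho>' (matrix_unit j i) (cnj_vec v)"
    if "(i, j) \<in> upper_positions" for i j
  proof (rule dual_reps_annihilates[OF dual])
    show "i \<noteq> j" using that by (auto simp: upper_positions_def)
    show "annihilates \<rho> (matrix_unit i j) v"
      using v that by (auto simp: highest_weight_space_def)
  qed
  ultimately show ?thesis unfolding lowest_weight_space_def by blast
qed

lemma dual_reps_lowest_weight_space:
  assumes dual: "dual_reps \<rho> \<rho>'" and v: "v \<in> lowest_weight_space \<rho>"
  shows "cnj_vec v \<in> highest_weight_space \<rho>'"
proof -
  obtain a b where "v \<in> weight_space \<rho> (a, b)"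
    using v by (auto simp: lowest_weight_space_def)
  then have "cnj_vec v \<in> weight_space \<rho>' (- a, - b)"
    by (rule dual_reps_weight_space[OF dual])
  moreover have "annihilates \<rho>' (matrix_unit i j) (cnj_vec v)"
    if "(i, j) \<in> upper_positions" for i j
  proof (rule dual_reps_annihilates[OF dual])
    show "j \<noteq> i" using that by (auto simp: upper_positions_def)
    show "annihilates \<rho> (matrix_unit j i) v"
      using v that by (auto simp: lowest_weight_space_def)
  qed
  ultimately show ?thesis unfolding highest_weight_space_def by blast
qed

text \<open>The reverse inclusions use the symmetry of \<open>dual_reps\<close> and that
  \<open>cnj_vec\<close> is an involution.\<close>

lemma dual_reps_extremal_weight_spaces:
  assumes "dual_reps \<rho> \<rho>'"
  shows "lowest_weight_space \<rho>' = cnj_vec ` highest_weight_space \<rho>"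
    and "highest_weight_space \<rho>' = cnj_vec ` lowest_weight_space \<rho>"
proof -
  have "v \<in> cnj_vec ` highest_weight_space \<rho>" if "v \<in> lowest_weight_space \<rho>'" for v
    using dual_reps_lowest_weight_space[OF dual_reps_sym[OF assms] that]
    by (metis cnj_vec_cnj_vec image_eqI)
  then show "lowest_weight_space \<rho>' = cnj_vec ` highest_weight_space \<rho>"
    using dual_reps_highest_weight_space[OF assms] by blast
  have "v \<in> cnj_vec ` lowest_weight_space \<rho>" if "v \<in> highest_weight_space \<rho>'" for v
    using dual_reps_highest_weight_space[OF dual_reps_sym[OF assms] that]
    by (metis cnj_vec_cnj_vec image_eqI)
  then show "highest_weight_space \<rho>' = cnj_vec ` lowest_weight_space \<rho>"
    using dual_reps_lowest_weight_space[OF assms] by blast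
qed

section \<open>The longest Weyl group element\<close>

text \<open>Minus the permutation matrix of the transposition \<open>(1 3)\<close>; the sign makes the
  determinant 1.\<close>

definition long_weyl :: "complex^3^3" where
  "long_weyl = (\<chi> i j. if (i, j) \<in> {(1, 3), (2, 2), (3, 1)} then - 1 else 0)"

definition weyl_perm :: "3 \<Rightarrow> 3" where
  "weyl_perm i = (if i = 1 then 3 else if i = 3 then 1 else 2)"

lemma weyl_perm_simps [simp]: "weyl_perm 1 = 3" "weyl_perm 2 = 2" "weyl_perm 3 = 1"
  by (simp_all add: weyl_perm_def)

lemma weyl_perm_weyl_perm [simp]: "weyl_perm (weyl_perm i) = i"
  using exhaust_3[of i] by auto

lemma weyl_perm_eq_iff [simp]: "weyl_perm i = weyl_perm j \<longleftrightarrow> i = j"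
  by (metis weyl_perm_weyl_perm)

text \<open>With this rule and the next, conjugation by \<open>long_weyl\<close> just permutes both
  indices: the two signs cancel.\<close>

lemma long_weyl_mult_nth [simp]: "(long_weyl ** A) $ i $ j = - A $ weyl_perm i $ j"
  using exhaust_3[of i]
  by (elim disjE) (simp_all add: matrix_matrix_mult_def long_weyl_def sum_3)

lemma mult_long_weyl_nth [simp]: "(A ** long_weyl) $ i $ j = - A $ i $ weyl_perm j"
  using exhaust_3[of j]
  by (elim disjE) (simp_all add: matrix_matrix_mult_def long_weyl_def sum_3)

lemma dagger_long_weyl: "dagger long_weyl = long_weyl"
  by (auto simp: vec_eq_iff long_weyl_def)

lemma long_weyl_square: "long_weyl ** long_weyl = mat 1"
proof -
  have "long_weyl $ i $ weyl_perm j = - mat 1 $ i $ j" for i j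
    using exhaust_3[of i] exhaust_3[of j]
    by (elim disjE) (simp_all add: long_weyl_def mat_nth)
  then show ?thesis by (simp add: vec_eq_iff)
qed

lemma long_weyl_in_SU3: "long_weyl \<in> SU3"
proof -
  have "det long_weyl = 1" by (simp add: det_3 long_weyl_def)
  then show ?thesis
    by (simp add: SU3_def unitary_def dagger_long_weyl long_weyl_square)
qed

lemma matrix_unit_weyl_perm:
  "matrix_unit (weyl_perm i) (weyl_perm j) = long_weyl ** matrix_unit i j ** long_weyl"
proof -
  have "k = weyl_perm i \<longleftrightarrow> weyl_perm k = i" for k i by (metis weyl_perm_weyl_perm)
  then show ?thesis by (simp add: vec_eq_iff matrix_unit_def)
qed

lemma diag_weyl_perm: "long_weyl ** diag t ** long_weyl = diag (\<chi> i. t $ weyl_perm i)"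
  by (simp add: vec_eq_iff diag_def)

text \<open>Conjugation preserves the cubic relation, so both sides are given by the closed form, a
  polynomial in X; the series is not touched again.\<close>

lemma mat_exp_long_weyl:
  assumes "X ** (X ** X) = (- 1 / 4) *\<^sub>R X"
  shows "mat_exp (t *\<^sub>R (long_weyl ** X ** long_weyl)) =
    long_weyl ** mat_exp (t *\<^sub>R X) ** long_weyl"
proof -
  let ?Y = "long_weyl ** X ** long_weyl"
  have mult: "(long_weyl ** A ** long_weyl) ** (long_weyl ** B ** long_weyl) =
      long_weyl ** (A ** B) ** long_weyl" for A B
  proof -
    have "(long_weyl ** A ** long_weyl) ** (long_weyl ** B ** long_weyl) =
        long_weyl ** A ** (long_weyl ** long_weyl) ** B ** long_weyl"
      by (simp only: matrix_mul_assoc)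
    then show ?thesis by (simp only: long_weyl_square matrix_mul_rid matrix_mul_assoc)
  qed
  have lin: "long_weyl ** (r *\<^sub>R A) ** long_weyl = r *\<^sub>R (long_weyl ** A ** long_weyl)" for r A
    by (simp add: vec_eq_iff)
  have "?Y ** (?Y ** ?Y) = (- 1 / 4) *\<^sub>R ?Y"
    unfolding mult assms lin ..
  note mat_exp_cubic[OF this]
  moreover have "long_weyl ** mat_exp (t *\<^sub>R X) ** long_weyl =
      mat 1 + (2 * sin (t / 2)) *\<^sub>R ?Y + (4 * (1 - cos (t / 2))) *\<^sub>R (?Y ** ?Y)"
    unfolding mat_exp_cubic[OF assms] mult by (simp add: vec_eq_iff mat_nth)
  ultimately show ?thesis by simp
qed

lemma unitary_rep_mat_exp_long_weyl:
  assumes \<rho>: "unitary_rep \<rho>" and X: "X ** (X ** X) = (- 1 / 4) *\<^sub>R X"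
    and SU3: "\<And>t. mat_exp (t *\<^sub>R X) \<in> SU3"
    and D: "((\<lambda>t. \<rho> (mat_exp (t *\<^sub>R X))) has_vector_derivative D) (at 0)"
  shows "((\<lambda>t. \<rho> (mat_exp (t *\<^sub>R (long_weyl ** X ** long_weyl)))) has_vector_derivative
    \<rho> long_weyl ** D ** \<rho> long_weyl) (at 0)"
proof -
  have "\<rho> (mat_exp (t *\<^sub>R (long_weyl ** X ** long_weyl))) =
      \<rho> long_weyl ** \<rho> (mat_exp (t *\<^sub>R X)) ** \<rho> long_weyl" for t
    unfolding mat_exp_long_weyl[OF X]
    using \<rho> SU3 long_weyl_in_SU3 by (simp add: unitary_rep_def SU3_mult)
  then show ?thesis
    using bounded_linear.has_vector_derivative[OF bounded_linear_matrix_sandwich D] by simp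
qed

text \<open>\<open>long_weyl\<close> is its own adjoint and inverse, so conjugation by it respects
  the splitting into X and Y; on operators conjugation is complex linear, so the two derivatives
  recombine.\<close>

lemma derived_rep_long_weyl:
  assumes \<rho>: "unitary_rep \<rho>" and "i \<noteq> j" and D: "derived_rep \<rho> (matrix_unit i j) D"
  shows "derived_rep \<rho> (matrix_unit (weyl_perm i) (weyl_perm j))
    (\<rho> long_weyl ** D ** \<rho> long_weyl)"
proof -
  define X Y where "X = skew_part (matrix_unit i j)" and "Y = herm_part (matrix_unit i j)"
  have parts: "skew_part (matrix_unit (weyl_perm i) (weyl_perm j)) = long_weyl ** X ** long_weyl"
    "herm_part (matrix_unit (weyl_perm i) (weyl_perm j)) = long_weyl ** Y ** long_weyl"
    unfolding X_def Y_def matrix_unit_weyl_perm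
    by (simp_all add: vec_eq_iff)
  obtain DX DY where
    DX: "((\<lambda>t. \<rho> (mat_exp (t *\<^sub>R X))) has_vector_derivative DX) (at 0)" and
    DY: "((\<lambda>t. \<rho> (mat_exp (t *\<^sub>R Y))) has_vector_derivative DY) (at 0)" and
    D_eq: "D = DX + mat \<i> ** DY"
    using D unfolding derived_rep_def Let_def X_def Y_def by blast
  have "A ** (mat c ** M) ** B = mat c ** (A ** M ** B)" for c and A M B :: "complex^'a^'a"
    by (simp add: vec_eq_iff matrix_matrix_mult_def[of _ B] matrix_matrix_mult_def[of A]
        sum_distrib_left sum_distrib_right mult_ac)
  then have "\<rho> long_weyl ** D ** \<rho> long_weyl =
      \<rho> long_weyl ** DX ** \<rho> long_weyl + mat \<i> ** (\<rho> long_weyl ** DY ** \<rho> long_weyl)"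
    unfolding D_eq
    using bounded_linear.linear[OF bounded_linear_matrix_sandwich, THEN linear_add] by metis
  moreover have "((\<lambda>t. \<rho> (mat_exp (t *\<^sub>R (long_weyl ** X ** long_weyl)))) has_vector_derivative
      \<rho> long_weyl ** DX ** \<rho> long_weyl) (at 0)"
    using skew_part_cube mat_exp_skew_part_in_SU3 \<open>i \<noteq> j\<close> DX
    unfolding X_def by (intro unitary_rep_mat_exp_long_weyl[OF \<rho>])
  moreover have "((\<lambda>t. \<rho> (mat_exp (t *\<^sub>R (long_weyl ** Y ** long_weyl)))) has_vector_derivative
      \<rho> long_weyl ** DY ** \<rho> long_weyl) (at 0)"
    using herm_part_cube mat_exp_herm_part_in_SU3 \<open>i \<noteq> j\<close> DY
    unfolding Y_def by (intro unitary_rep_mat_exp_long_weyl[OF \<rho>])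
  ultimately show ?thesis
    unfolding derived_rep_def Let_def parts by blast
qed

lemma unitary_rep_long_weyl_square:
  "unitary_rep \<rho> \<Longrightarrow> \<rho> long_weyl ** \<rho> long_weyl = mat 1"
  using long_weyl_in_SU3 long_weyl_square unitary_rep_one unfolding unitary_rep_def by metis

lemma annihilates_long_weyl:
  assumes "unitary_rep \<rho>" "i \<noteq> j" "annihilates \<rho> (matrix_unit i j) v"
  shows "annihilates \<rho> (matrix_unit (weyl_perm i) (weyl_perm j)) (\<rho> long_weyl *v v)"
proof -
  obtain D where D: "derived_rep \<rho> (matrix_unit i j) D" "D *v v = 0"
    using assms(3) by (auto simp: annihilates_def)
  have "(\<rho> long_weyl ** D ** \<rho> long_weyl) *v (\<rho> long_weyl *v v) =
      (\<rho> long_weyl ** D ** (\<rho> long_weyl ** \<rho> long_weyl)) *v v"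
    by (simp only: matrix_vector_mul_assoc matrix_mul_assoc)
  also have "\<dots> = \<rho> long_weyl *v (D *v v)"
    unfolding unitary_rep_long_weyl_square[OF assms(1)] matrix_vector_mul_assoc matrix_mul_rid ..
  also have "\<dots> = 0"
    unfolding D(2) by (simp add: matrix_vector_mult_0_right)
  finally show ?thesis
    using derived_rep_long_weyl[OF assms(1,2) D(1)] by (auto simp: annihilates_def)
qed

text \<open>Moving a torus element past \<open>long_weyl\<close> exchanges its first and third
  entries. As the three entries have product 1, the first entry of \<open>s\<close> is the inverse
  of t1 t2 and the product of its first two is the inverse of t1.\<close>

lemma weight_space_long_weyl:
  assumes \<rho>: "unitary_rep \<rho>" and v: "v \<in> weight_space \<rho> (a, b)"
  shows "\<rho> long_weyl *v v \<in> weight_space \<rho> (- b, - a)"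
proof -
  have "\<rho> (diag t) *v (\<rho> long_weyl *v v) =
      ((t $ 1) powi (- b) * (t $ 1 * t $ 2) powi (- a)) *s (\<rho> long_weyl *v v)"
    if t: "diag t \<in> SU3" for t
  proof -
    define s where "s = (\<chi> i. t $ weyl_perm i)"
    have s: "diag s = long_weyl ** diag t ** long_weyl"
      by (simp add: s_def diag_weyl_perm)
    then have s_SU3: "diag s \<in> SU3" using t long_weyl_in_SU3 by (simp add: SU3_mult)
    have "diag t ** long_weyl = long_weyl ** diag s"
      by (simp add: s matrix_mul_assoc long_weyl_square)
    then have "\<rho> (diag t) ** \<rho> long_weyl = \<rho> long_weyl ** \<rho> (diag s)"
      using \<rho> t s_SU3 long_weyl_in_SU3 unfolding unitary_rep_def by metis
    then have "\<rho> (diag t) *v (\<rho> long_weyl *v v) = \<rho> long_weyl *v (\<rho> (diag s) *v v)"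
      by (simp add: matrix_vector_mul_assoc)
    also have "\<dots> = ((s $ 1) powi a * (s $ 1 * s $ 2) powi b) *s (\<rho> long_weyl *v v)"
      using v s_SU3 by (simp add: weight_space_def vector_scalar_commute)
    also have "(s $ 1) powi a * (s $ 1 * s $ 2) powi b =
        (t $ 1) powi (- b) * (t $ 1 * t $ 2) powi (- a)"
    proof -
      have det: "t $ 1 * t $ 2 * t $ 3 = 1"
        using t by (simp add: SU3_def det_3 diag_def)
      then have "inverse (t $ 1 * t $ 2) = s $ 1" "inverse (t $ 1) = s $ 1 * s $ 2"
        by (intro inverse_unique; simp add: s_def mult_ac)+
      then show ?thesis
        by (simp only: power_int_inverse[symmetric] power_int_minus mult.commute)
    qed
    finally show ?thesis .
  qed
  then show ?thesis by (simp add: weight_space_def)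
qed

lemma highest_weight_space_long_weyl:
  assumes \<rho>: "unitary_rep \<rho>" and v: "v \<in> highest_weight_space \<rho>"
  shows "\<rho> long_weyl *v v \<in> lowest_weight_space \<rho>"
proof -
  obtain a b where "v \<in> weight_space \<rho> (a, b)"
    using v by (auto simp: highest_weight_space_def)
  then have "\<rho> long_weyl *v v \<in> weight_space \<rho> (- b, - a)"
    by (rule weight_space_long_weyl[OF \<rho>])
  moreover have "annihilates \<rho> (matrix_unit j i) (\<rho> long_weyl *v v)"
    if ij: "(i, j) \<in> upper_positions" for i j
  proof -
    \<comment> \<open>\<open>weyl_perm\<close> reverses the order 1, 2, 3, so it turns a strictly
      lower position into a strictly upper one.\<close>
    have "(weyl_perm j, weyl_perm i) \<in> upper_positions"
      using ij by (auto simp: upper_positions_def)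
    then have "annihilates \<rho> (matrix_unit (weyl_perm j) (weyl_perm i)) v"
      using v by (auto simp: highest_weight_space_def)
    moreover have "weyl_perm j \<noteq> weyl_perm i" using ij by (auto simp: upper_positions_def)
    ultimately show ?thesis using annihilates_long_weyl[OF \<rho>] by fastforce
  qed
  ultimately show ?thesis unfolding lowest_weight_space_def by blast
qed

text \<open>The conjugate of v is only a lowest weight vector. Applying \<open>long_weyl\<close>
  first takes the weight from (p, q) to (-q, -p), and conjugation then gives (q, p).\<close>

lemma dual_reps_irrep_with_highest_weight:
  assumes dual: "dual_reps \<rho> \<rho>'" and irrep: "irrep_with_highest_weight pq \<rho>"
  shows "irrep_with_highest_weight (dual_weight pq) \<rho>'"
proof -
  obtain p q where pq: "pq = (p, q)" by fastforce
  obtain v where v: "v \<noteq> 0" "v \<in> highest_weight_space \<rho>" "v \<in> weight_space \<rho> (int p, int q)"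
    using irrep by (auto simp: irrep_with_highest_weight_def pq)
  have \<rho>: "unitary_rep \<rho>" "unitary_rep \<rho>'" using dual by (auto simp: dual_reps_def)
  define u where "u = cnj_vec (\<rho> long_weyl *v v)"
  have "\<rho> long_weyl *v (\<rho> long_weyl *v v) = v"
    by (simp add: matrix_vector_mul_assoc unitary_rep_long_weyl_square[OF \<rho>(1)])
  then have "\<rho> long_weyl *v v \<noteq> 0"
    using v(1) matrix_vector_mult_0_right by metis
  then have "u \<noteq> 0" by (simp add: u_def)
  moreover have "u \<in> highest_weight_space \<rho>'"
    unfolding u_def
    using dual_reps_lowest_weight_space[OF dual] highest_weight_space_long_weyl[OF \<rho>(1) v(2)]
    by blast
  moreover have "u \<in> weight_space \<rho>' (int q, int p)"
    using dual_reps_weight_space[OF dual weight_space_long_weyl[OF \<rho>(1) v(3)]]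
    by (simp add: u_def)
  moreover have "irreducible_rep \<rho>'"
    using dual_reps_irreducible[OF dual] irrep by (auto simp: irrep_with_highest_weight_def)
  ultimately show ?thesis
    using \<rho> by (auto simp: irrep_with_highest_weight_def dual_weight_def pq)
qed

section \<open>Transitivity on the projective plane\<close>

lemma SU3_first_column:
  assumes "(cmod a)\<^sup>2 + (cmod b)\<^sup>2 + (cmod c)\<^sup>2 = 1"
  shows "\<exists>g\<in>SU3. g *v axis 1 1 = vector [a, b, c]"
proof -
  have norm: "a * cnj a + b * cnj b + c * cnj c = 1"
    using assms unfolding complex_norm_square[symmetric]
    by (metis of_real_1 of_real_add of_real_power)
  show ?thesis
  proof (cases "a = 0 \<and> b = 0")
    case True
    \<comment> \<open>A cyclic permutation matrix with phases; the extra \<open>cnj c\<close> makes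
      the determinant c * cnj c = 1.\<close>
    define g :: "complex^3^3" where "g = vector [vector [0, 1, 0], vector [0, 0, cnj c], vector [c, 0, 0]]"
    have "dagger g ** g = mat 1"
      using True norm
      by (simp add: g_def vec_eq_iff forall_3 matrix_matrix_mult_def sum_3 mat_nth mult.commute)
    moreover have "det g = 1" using True norm by (simp add: g_def det_3 mult.commute)
    moreover have "g *v axis 1 1 = vector [a, b, c]"
      using True by (simp add: g_def vec_eq_iff forall_3 matrix_vector_mult_def sum_3 axis_def)
    ultimately show ?thesis using unitaryI[of g] by (auto simp: SU3_def)
  next
    case False
    define r where "r = complex_of_real (sqrt ((cmod a)\<^sup>2 + (cmod b)\<^sup>2))"
    have "(cmod a)\<^sup>2 + (cmod b)\<^sup>2 > 0"
      using False by (simp add: sum_power2_gt_zero_iff)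
    then have "r \<noteq> 0"
      unfolding r_def by (metis of_real_eq_0_iff order_less_irrefl real_sqrt_eq_zero_cancel_iff)
    \<comment> \<open>\<open>u\<close> is 1/r, kept as an unknown with a polynomial relation so that
      no division occurs in the identities below.\<close>
    then obtain u where u: "u * r = 1" by (metis left_inverse)
    have "r * r = complex_of_real ((cmod a)\<^sup>2 + (cmod b)\<^sup>2)"
      unfolding r_def of_real_mult[symmetric] by (simp add: real_sqrt_mult_self)
    then have rr: "r * r = a * cnj a + b * cnj b"
      by (simp only: complex_norm_square of_real_add)
    have cc: "c * cnj c = 1 - r * r" using norm rr by (simp add: algebra_simps)
    have r: "cnj r = r" by (simp add: r_def)
    then have "cnj u * r = 1" using u by (metis complex_cnj_mult complex_cnj_one)
    then have cnj_u: "cnj u = u" using u \<open>r \<noteq> 0\<close> by (metis mult_right_cancel)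
    \<comment> \<open>The second column is (-cnj b, cnj a, 0) normalised, orthogonal to the first;
      the third is the conjugate of the cross product of the first two.\<close>
    define g :: "complex^3^3" where "g = vector [vector [a, - (cnj b * u), - (a * cnj c * u)],
      vector [b, cnj a * u, - (b * cnj c * u)], vector [c, 0, r]]"
    have g: "g $ 1 $ 1 = a" "g $ 1 $ 2 = - (cnj b * u)" "g $ 1 $ 3 = - (a * cnj c * u)"
      "g $ 2 $ 1 = b" "g $ 2 $ 2 = cnj a * u" "g $ 2 $ 3 = - (b * cnj c * u)"
      "g $ 3 $ 1 = c" "g $ 3 $ 2 = 0" "g $ 3 $ 3 = r"
      by (simp_all add: g_def)
    have "dagger g ** g = mat 1"
      unfolding vec_eq_iff forall_3 matrix_matrix_mult_def sum_3 mat_nth dagger_nth vec_lambda_beta g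
      by (intro conjI; simp add: cnj_u r; use rr cc u in algebra)
    moreover have "det g = 1"
      unfolding det_3 g using rr cc u by algebra
    moreover have "g *v axis 1 1 = vector [a, b, c]"
      by (simp add: g_def vec_eq_iff forall_3 matrix_vector_mult_def sum_3 axis_def)
    ultimately show ?thesis using unitaryI[of g] by (auto simp: SU3_def)
  qed
qed

lemma Rep_cp2_homog: "z \<noteq> 0 \<Longrightarrow> Rep_cp2 (homog z) = range (\<lambda>c. c *s z)"
  unfolding homog_def by (intro Abs_cp2_inverse) blast

text \<open>A representative of x is normalised to a unit vector and completed to a special unitary
  matrix; the factor k does not change the line.\<close>

lemma SU3_transitive:
  obtains g where "g \<in> SU3" "cp2_act g x0 = x"
proof -
  obtain z :: "complex^3" where z: "z \<noteq> 0" "Rep_cp2 x = range (\<lambda>c. c *s z)"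
    using Rep_cp2[of x] by auto
  define k where "k = complex_of_real (1 / norm z)"
  have "k \<noteq> 0" using z(1) by (simp add: k_def)
  have "(norm z)\<^sup>2 = (cmod (z $ 1))\<^sup>2 + (cmod (z $ 2))\<^sup>2 + (cmod (z $ 3))\<^sup>2"
    by (simp add: norm_vec_def L2_set_def sum_3)
  moreover have "(norm z)\<^sup>2 \<noteq> 0" using z(1) by simp
  ultimately have "(cmod (k * z $ 1))\<^sup>2 + (cmod (k * z $ 2))\<^sup>2 + (cmod (k * z $ 3))\<^sup>2 = 1"
    by (simp add: k_def norm_mult norm_divide power_mult_distrib power_divide
        add_divide_distrib[symmetric])
  then obtain g where g: "g \<in> SU3" "g *v axis 1 1 = vector [k * z $ 1, k * z $ 2, k * z $ 3]"
    using SU3_first_column by blast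
  have gz: "g *v axis 1 1 = k *s z"
    unfolding g(2) by (simp add: vec_eq_iff forall_3)
  have "(\<lambda>v. g *v v) ` Rep_cp2 x0 = range (\<lambda>c. c *s (k *s z))"
    by (simp add: x0_def Rep_cp2_homog axis_eq_0_iff image_image vector_scalar_commute gz)
  also have "\<dots> = range (\<lambda>c. c *s z)"
  proof -
    have "range (\<lambda>c. c * k) = UNIV"
      using \<open>k \<noteq> 0\<close> by (intro surjI[of _ "\<lambda>c. c / k"]) simp
    then have "range (\<lambda>c. c *s z) = (\<lambda>c. c *s z) ` range (\<lambda>c. c * k)" by simp
    then show ?thesis by (simp add: image_image vector_smult_assoc)
  qed
  finally have "cp2_act g x0 = x"
    by (simp add: cp2_act_def z(2)[symmetric] Rep_cp2_inverse)
  then show ?thesis using that g(1) by blast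
qed

text \<open>A kernel prescribes the symbols along the orbit of \<open>x0\<close>, which is the whole
  plane.\<close>

lemma operator_kernel_determines:
  assumes "operator_kernel \<rho> V K" "operator_kernel \<rho> W K"
  shows "V = W"
proof (intro ext)
  fix A x
  obtain g where "g \<in> SU3" "cp2_act g x0 = x" by (rule SU3_transitive)
  then show "V A x = W A x" using assms unfolding operator_kernel_def by metis
qed

section \<open>Transport of symbol correspondences\<close>

text \<open>This is the antipodal correspondence of W as a function of W.\<close>

definition transpose_correspondence ::
    "(complex^'n^'n \<Rightarrow> cp2 \<Rightarrow> complex) \<Rightarrow> complex^'n^'n \<Rightarrow> cp2 \<Rightarrow> complex" where
  "transpose_correspondence W A = W (transpose A)"

lemma antipodal_iff: "antipodal W W' \<longleftrightarrow> W' = transpose_correspondence W"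
  unfolding antipodal_def transpose_correspondence_def fun_eq_iff
  by (metis transpose_transpose)

text \<open>Transposing a product reverses it, and the transposes of \<open>\<rho> g\<close> and of
  its adjoint are the adjoint of \<open>\<rho>' g\<close> and \<open>\<rho>' g\<close>
  itself.\<close>

lemma dual_reps_op_act:
  assumes "dual_reps \<rho> \<rho>'" "g \<in> SU3"
  shows "op_act \<rho>' g (transpose A) = transpose (op_act \<rho> g A)"
proof -
  have "unitary (\<rho> g)" "unitary (\<rho>' g)" and "\<rho>' g = cnj_mat (\<rho> g)"
    using assms by (auto simp: dual_reps_def unitary_rep_def)
  then show ?thesis
    by (simp add: op_act_def unitary_matrix_inv matrix_transpose_mul dagger_cnj_mat
        transpose_dagger matrix_mul_assoc)
qed

lemma symbol_correspondence_transpose: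
  assumes dual: "dual_reps \<rho> \<rho>'" and W: "symbol_correspondence \<rho> W"
  shows "symbol_correspondence \<rho>' (transpose_correspondence W)"
proof -
  have "inj (transpose_correspondence W)"
    using W unfolding symbol_correspondence_def transpose_correspondence_def inj_def
    by (metis transpose_transpose)
  moreover have "transpose (op_act \<rho>' g A) = op_act \<rho> g (transpose A)" if "g \<in> SU3" for g A
    using dual_reps_op_act[OF dual that, of "transpose A"] by simp
  moreover have "transpose (A + B) = transpose A + transpose B" for A B :: "complex^'a^'a"
    by (simp add: vec_eq_iff)
  ultimately show ?thesis
    using W
    by (simp add: symbol_correspondence_def transpose_correspondence_def transpose_mat_mult
        trace_transpose dagger_transpose[symmetric])
qed

lemma operator_kernel_transpose:
  assumes dual: "dual_reps \<rho> \<rho>'" and K: "operator_kernel \<rho> W K"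
  shows "operator_kernel \<rho>' (transpose_correspondence W) (transpose K)"
proof -
  have "op_act \<rho>' h (transpose K) = transpose K" if "h \<in> isotropy_group" for h
    using that K dual_reps_op_act[OF dual] by (simp add: operator_kernel_def isotropy_group_def)
  moreover have "W (transpose A) (cp2_act g x0) = trace (A ** op_act \<rho>' g (transpose K))"
    if "g \<in> SU3" for A g
  proof -
    \<comment> \<open>The trace is invariant under transposition, which reverses the product;
      cyclicity then restores the order.\<close>
    have "trace (A ** op_act \<rho>' g (transpose K)) = trace (transpose (op_act \<rho> g K ** transpose A))"
      by (simp add: dual_reps_op_act[OF dual that] matrix_transpose_mul)
    also have "\<dots> = trace (transpose A ** op_act \<rho> g K)"
      unfolding trace_transpose by (rule trace_mul_sym)
    finally show ?thesis using K that by (simp add: operator_kernel_def)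
  qed
  ultimately show ?thesis
    by (simp add: operator_kernel_def transpose_correspondence_def)
qed

lemma moduli_space_transpose:
  assumes "dual_reps \<rho> \<rho>'" "K \<in> moduli_space \<rho>"
  shows "transpose K \<in> moduli_space \<rho>'"
  using assms symbol_correspondence_transpose operator_kernel_transpose
  unfolding moduli_space_def by blast

lemma stratonovich_weyl_transpose:
  assumes "dual_reps \<rho> \<rho>'" and W: "stratonovich_weyl \<rho> W"
  shows "stratonovich_weyl \<rho>' (transpose_correspondence W)"
proof -
  have "op_inner (transpose A) (transpose B) = op_inner A B" for A B :: "complex^'a^'a"
  proof -
    have "trace (dagger (transpose A) ** transpose B) = trace (transpose (B ** dagger A))"
      by (simp add: dagger_transpose matrix_transpose_mul)
    also have "\<dots> = trace (dagger A ** B)"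
      unfolding trace_transpose by (rule trace_mul_sym)
    finally show ?thesis by (simp add: op_inner_def)
  qed
  then show ?thesis
    using W symbol_correspondence_transpose[OF assms(1)]
    by (simp add: stratonovich_weyl_def transpose_correspondence_def[abs_def])
qed

text \<open>Duality swaps the components of the weight and also the extremal weight spaces, so the
  two alternatives in \<open>symmetric_berezin\<close> trade places.\<close>

lemma symmetric_berezin_transpose:
  assumes dual: "dual_reps \<rho> \<rho>'" and W: "symmetric_berezin pq \<rho> W"
  shows "symmetric_berezin (dual_weight pq) \<rho>' (transpose_correspondence W)"
proof -
  obtain K where K: "operator_kernel \<rho> W K"
    "snd pq = 0 \<and> orthogonal_projector_onto (highest_weight_space \<rho>) K \<or>
     fst pq = 0 \<and> orthogonal_projector_onto (lowest_weight_space \<rho>) K"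
    using W by (auto simp: symmetric_berezin_def)
  have "fst (dual_weight pq) = snd pq" "snd (dual_weight pq) = fst pq"
    by (simp_all add: dual_weight_def split_beta)
  then have "fst (dual_weight pq) = 0 \<and>
        orthogonal_projector_onto (lowest_weight_space \<rho>') (transpose K) \<or>
      snd (dual_weight pq) = 0 \<and>
        orthogonal_projector_onto (highest_weight_space \<rho>') (transpose K)"
    using K(2) orthogonal_projector_onto_transpose[of _ K]
    unfolding dual_reps_extremal_weight_spaces[OF dual] by auto
  then show ?thesis
    using W K(1) dual_reps_irrep_with_highest_weight[OF dual]
      symbol_correspondence_transpose[OF dual] operator_kernel_transpose[OF dual]
    unfolding symmetric_berezin_def by blast
qed

text \<open>Transposition is continuous and maps one moduli space into the other, so it carries a
  connected set joining two kernels to one joining their transposes.\<close>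

lemma sw_in_berezin_component_transpose:
  assumes dual: "dual_reps \<rho> \<rho>'" and W: "sw_in_berezin_component pq \<rho> W"
  shows "sw_in_berezin_component (dual_weight pq) \<rho>' (transpose_correspondence W)"
proof -
  obtain B K\<^sub>B K where B: "symmetric_berezin pq \<rho> B" "operator_kernel \<rho> B K\<^sub>B"
    and K: "operator_kernel \<rho> W K" "connected_component (moduli_space \<rho>) K\<^sub>B K"
    using W by (auto simp: sw_in_berezin_component_def)
  obtain T where T: "connected T" "T \<subseteq> moduli_space \<rho>" "K\<^sub>B \<in> T" "K \<in> T"
    using K(2) by (auto simp: connected_component_def)
  have "continuous_on T (transpose :: complex^'a^'a \<Rightarrow> _)"
    by (intro linear_continuous_on bounded_linear_transpose)
  then have "connected (transpose ` T)"
    using T(1) connected_continuous_image by blast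
  moreover have "transpose ` T \<subseteq> moduli_space \<rho>'"
    using T(2) moduli_space_transpose[OF dual] by blast
  ultimately have "connected_component (moduli_space \<rho>') (transpose K\<^sub>B) (transpose K)"
    using T(3,4) unfolding connected_component_def by blast
  then show ?thesis
    using W stratonovich_weyl_transpose[OF dual] symmetric_berezin_transpose[OF dual B(1)]
      operator_kernel_transpose[OF dual B(2)] operator_kernel_transpose[OF dual K(1)]
    unfolding sw_in_berezin_component_def by blast
qed

section \<open>Uniqueness and duality of the symmetric correspondences\<close>

lemma symmetric_berezin_unique:
  assumes "pq = (p, 0) \<or> pq = (0, p)" "p \<ge> 1"
    and V: "symmetric_berezin pq \<rho> V" and W: "symmetric_berezin pq \<rho> W"
  shows "V = W"
proof -
  \<comment> \<open>Since p is positive, exactly one component of \<open>pq\<close> vanishes, so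
    only one alternative of \<open>symmetric_berezin\<close> applies and \<open>S\<close> is its
    weight space.\<close>
  define S where "S = (if snd pq = 0 then highest_weight_space \<rho> else lowest_weight_space \<rho>)"
  have kernel: "\<exists>K. operator_kernel \<rho> X K \<and> orthogonal_projector_onto S K"
    if "symmetric_berezin pq \<rho> X" for X
    using that assms(1,2) by (auto simp: symmetric_berezin_def S_def)
  obtain K L where "operator_kernel \<rho> V K" "operator_kernel \<rho> W L"
    and "orthogonal_projector_onto S K" "orthogonal_projector_onto S L"
    using kernel[OF V] kernel[OF W] by blast
  moreover from this have "K = L" by (blast intro: orthogonal_projector_onto_unique)
  ultimately show ?thesis using operator_kernel_determines by blast
qed

lemma dual_weight_dual_weight [simp]: "dual_weight (dual_weight pq) = pq"
  by (simp add: dual_weight_def split_beta)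

lemma transpose_correspondence_involutive [simp]:
  "transpose_correspondence (transpose_correspondence W) = W"
  by (simp add: transpose_correspondence_def fun_eq_iff)

theorem theorem4p23:
  fixes \<rho> :: "complex^3^3 \<Rightarrow> complex^'n^'n" and p :: nat and pq :: "nat \<times> nat"
  assumes "p \<ge> 1"
    and "pq = (p, 0) \<or> pq = (0, p)"
    and "irrep_with_highest_weight pq \<rho>"
  shows "(\<forall>W W'. symmetric_berezin pq \<rho> W \<longrightarrow>
            (symmetric_berezin (dual_weight pq) (dual_rep \<rho>) W' \<longleftrightarrow> antipodal W W')) \<and>
         (\<forall>W W'. symmetric_stratonovich_weyl pq \<rho> W \<longrightarrow>
            (symmetric_stratonovich_weyl (dual_weight pq) (dual_rep \<rho>) W' \<longleftrightarrow> antipodal W W'))"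
proof -
  have "unitary_rep \<rho>"
    using assms(3) by (auto simp: irrep_with_highest_weight_def split: prod.splits)
  then have dual: "dual_reps \<rho> (dual_rep \<rho>)" by (rule dual_reps_dual_rep)
  note dual' = dual_reps_sym[OF dual]
  have "symmetric_berezin (dual_weight pq) (dual_rep \<rho>) W' \<longleftrightarrow> W' = transpose_correspondence W"
    if "symmetric_berezin pq \<rho> W" for W W'
  proof
    assume "symmetric_berezin (dual_weight pq) (dual_rep \<rho>) W'"
    \<comment> \<open>W' is carried back to \<rho>, where uniqueness compares it with W.\<close>
    from symmetric_berezin_transpose[OF dual' this] have "transpose_correspondence W' = W"
      using symmetric_berezin_unique[OF assms(2,1) _ that] by simp
    then show "W' = transpose_correspondence W" by auto
  qed (use symmetric_berezin_transpose[OF dual that] in simp)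
  moreover have "symmetric_stratonovich_weyl (dual_weight pq) (dual_rep \<rho>) W' \<longleftrightarrow>
      W' = transpose_correspondence W"
    if W: "symmetric_stratonovich_weyl pq \<rho> W" for W W'
  proof
    assume "symmetric_stratonovich_weyl (dual_weight pq) (dual_rep \<rho>) W'"
    then have "sw_in_berezin_component pq \<rho> (transpose_correspondence W')"
      using sw_in_berezin_component_transpose[OF dual', of "dual_weight pq" W']
      by (simp add: symmetric_stratonovich_weyl_def)
    then have "transpose_correspondence W' = W"
      using W by (simp add: symmetric_stratonovich_weyl_def)
    then show "W' = transpose_correspondence W" by auto
  next
    assume W': "W' = transpose_correspondence W"
    \<comment> \<open>Uniqueness on the dual side is inherited: a competitor V carried back to
      \<rho> must equal W.\<close>
    have "V = W'" if "sw_in_berezin_component (dual_weight pq) (dual_rep \<rho>) V" for V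
    proof -
      have "transpose_correspondence V = W"
        using sw_in_berezin_component_transpose[OF dual' that] W
        by (simp add: symmetric_stratonovich_weyl_def)
      then show ?thesis using W' by auto
    qed
    then show "symmetric_stratonovich_weyl (dual_weight pq) (dual_rep \<rho>) W'"
      using W sw_in_berezin_component_transpose[OF dual, of pq W]
      unfolding symmetric_stratonovich_weyl_def W' by blast
  qed
  ultimately show ?thesis by (simp add: antipodal_iff)
qed

end
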